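(* Let $G$ be a connected graph of odd size. If $G$ is decomposable, then $G$ contains a locally irregular subgraph $H$ such that every connected component of $G-E(H)$ has even size.
   Context: All graphs are finite and simple. The size of a graph is its number of edges. A graph is locally irregular if any two adjacent vertices have distinct degrees. $G$ is decomposable if its edge set can be partitioned into (edge sets of) locally irregular subgraphs. *)

theory Defs
  imports Main "HOL-Library.Disjoint_Sets"
begin

record 'a ugraph =
  verts :: "'a set"
  edges :: "'a set set"

definition simple_graph :: "'a ugraph \<Rightarrow> bool" where
  "simple_graph G \<longleftrightarrow> finite (verts G) \<and> (\<forall>e\<in>edges G. e \<subseteq> verts G \<and> card e = 2)"

definition size_of :: "'a ugraph \<Rightarrow> nat" where
  "size_of G = card (edges G)"

definition adj :: "'a ugraph \<Rightarrow> 'a \<Rightarrow> 'a \<Rightarrow> bool" where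
  "adj G u v \<longleftrightarrow> {u, v} \<in> edges G"

definition degree :: "'a ugraph \<Rightarrow> 'a \<Rightarrow> nat" where
  "degree G v = card {e \<in> edges G. v \<in> e}"

definition subgraph :: "'a ugraph \<Rightarrow> 'a ugraph \<Rightarrow> bool" where
  "subgraph H G \<longleftrightarrow> simple_graph H \<and> verts H \<subseteq> verts G \<and> edges H \<subseteq> edges G"

(* The graph without vertices is not regarded as connected. *)
definition connected_graph :: "'a ugraph \<Rightarrow> bool" where
  "connected_graph G \<longleftrightarrow>
     verts G \<noteq> {} \<and> (\<forall>u\<in>verts G. \<forall>v\<in>verts G. (adj G)\<^sup>*\<^sup>* u v)"

definition component :: "'a ugraph \<Rightarrow> 'a ugraph \<Rightarrow> bool" where
  "component C G \<longleftrightarrow>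
     subgraph C G \<and> connected_graph C \<and>
     (\<forall>D. subgraph D G \<and> connected_graph D \<and> subgraph C D \<longrightarrow> D = C)"

(* Degrees are taken in G itself: for a subgraph H of G, locally_irregular H
   refers to the degrees in H, not in G. *)
definition locally_irregular :: "'a ugraph \<Rightarrow> bool" where
  "locally_irregular G \<longleftrightarrow>
     (\<forall>u\<in>verts G. \<forall>v\<in>verts G. adj G u v \<longrightarrow> degree G u \<noteq> degree G v)"

definition decomposable :: "'a ugraph \<Rightarrow> bool" where
  "decomposable G \<longleftrightarrow>
     (\<exists>P. partition_on (edges G) P \<and>
          (\<forall>F\<in>P. \<exists>H. subgraph H G \<and> locally_irregular H \<and> edges H = F))"

definition delete_edges :: "'a ugraph \<Rightarrow> 'a set set \<Rightarrow> 'a ugraph" where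
  "delete_edges G F = G\<lparr>edges := edges G - F\<rparr>"

end

theory Submission imports Defs begin

text \<open>
  If \<open>E - H\<close> has an orientation with all indegrees even, then every component of \<open>G - E(H)\<close> has
  even size. Since \<open>G\<close> is connected of odd size, for every vertex \<open>v\<close> there is an orientation in
  which exactly \<open>v\<close> has odd indegree, and reversing a cycle gives another one.

  Suppose that no suitable \<open>H\<close> exists. Three edges entering \<open>v\<close> would form a claw \<open>H\<close>, so the
  indegree of \<open>v\<close> is always 1. A claw at \<open>v\<close> with two of its legs extended (degrees 3, 2, 2, 1, 1, 1)
  is excluded as well; this forces maximum degree at most 3, every vertex of degree 3 lies on a
  triangle, and the third edge at such a vertex is a bridge.

  Now take a decomposition into locally irregular subgraphs, seen as an edge colouring. By induction
  on the side \<open>R \<ni> v\<close> of a bridge \<open>uv\<close>, the degree of \<open>v\<close> in the colour of \<open>uv\<close> is 2 if \<open>R\<close> spans an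
  odd number of edges, and 1 otherwise. The total size is odd, so both sides have the same parity and
  both ends of a bridge have the same colour degree, which is impossible. Hence there is no bridge,
  \<open>G\<close> is a cycle, and each colour splits into paths with two edges, so the size would be even.
\<close>

section \<open>Orientations and parity\<close>

text \<open>\<open>h e\<close> is the head of \<open>e\<close>. With this encoding, reversing an
  edge is a function update.\<close>

definition orients :: "('a set \<Rightarrow> 'a) \<Rightarrow> 'a set set \<Rightarrow> bool" where
  "orients h E \<longleftrightarrow> (\<forall>e\<in>E. h e \<in> e)"

definition indeg :: "'a set set \<Rightarrow> ('a set \<Rightarrow> 'a) \<Rightarrow> 'a \<Rightarrow> nat" where
  "indeg E h x = card {e \<in> E. h e = x}"

definition token_at :: "'a set set \<Rightarrow> 'a \<Rightarrow> ('a set \<Rightarrow> 'a) \<Rightarrow> bool" where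
  "token_at E v h \<longleftrightarrow> orients h E \<and> (\<forall>x. odd (indeg E h x) \<longleftrightarrow> x = v)"

definition edge_deg :: "'a set set \<Rightarrow> 'a \<Rightarrow> nat" where
  "edge_deg F x = card {e \<in> F. x \<in> e}"

definition irregular_edges :: "'a set set \<Rightarrow> bool" where
  "irregular_edges F \<longleftrightarrow> (\<forall>u v. {u, v} \<in> F \<longrightarrow> edge_deg F u \<noteq> edge_deg F v)"

lemma edge_deg_empty: "edge_deg {} x = 0"
  by (simp add: edge_deg_def)

lemma edge_deg_insert:
  assumes "finite F" "e \<notin> F"
  shows "edge_deg (insert e F) x = edge_deg F x + (if x \<in> e then 1 else 0)"
proof -
  have "{f \<in> insert e F. x \<in> f} = (if x \<in> e then insert e {f \<in> F. x \<in> f} else {f \<in> F. x \<in> f})"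
    by auto
  with assms show ?thesis by (simp add: edge_deg_def)
qed

lemma indeg_empty: "indeg {} h x = 0"
  by (simp add: indeg_def)

lemma indeg_insert:
  assumes "finite F" "e \<notin> F"
  shows "indeg (insert e F) h x = indeg F h x + (if h e = x then 1 else 0)"
proof -
  have "{f \<in> insert e F. h f = x} = (if h e = x then insert e {f \<in> F. h f = x} else {f \<in> F. h f = x})"
    by auto
  with assms show ?thesis by (simp add: indeg_def)
qed

lemma indeg_Diff:
  assumes "finite E" "H \<subseteq> E"
  shows "indeg E h x = indeg (E - H) h x + indeg H h x"
proof -
  have "{e \<in> E. h e = x} = {e \<in> E - H. h e = x} \<union> {e \<in> H. h e = x}"
    using assms by auto
  moreover have "card ({e \<in> E - H. h e = x} \<union> {e \<in> H. h e = x})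
      = card {e \<in> E - H. h e = x} + card {e \<in> H. h e = x}"
    using assms by (intro card_Un_disjoint) (auto intro: finite_subset)
  ultimately show ?thesis by (simp add: indeg_def)
qed

text \<open>Redirecting \<open>e\<close> toggles the parity at its old head and at \<open>w\<close>.
  The inner inequality of truth values is an exclusive or, so the two toggles cancel when
  \<open>w = h e\<close>.\<close>

lemma indeg_fun_upd:
  assumes "finite E" "e \<in> E"
  shows "odd (indeg E (h(e := w)) x) \<longleftrightarrow> (odd (indeg E h x) \<noteq> ((x = h e) \<noteq> (x = w)))"
proof -
  have E: "E = insert e (E - {e})" using assms by auto
  have 1: "indeg E g x = indeg (E - {e}) g x + (if g e = x then 1 else 0)" for g
    using indeg_insert[of "E - {e}" e] assms E by auto
  have "{f \<in> E - {e}. (h(e := w)) f = x} = {f \<in> E - {e}. h f = x}" by auto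
  then have 2: "indeg (E - {e}) (h(e := w)) x = indeg (E - {e}) h x"
    unfolding indeg_def by argo
  show ?thesis unfolding 1 2 by auto
qed

lemma card_heads:
  assumes "finite E" "finite R"
  shows "card {e \<in> E. h e \<in> R} = (\<Sum>x\<in>R. indeg E h x)"
proof -
  have "{e \<in> E. h e \<in> R} = (\<Union>x\<in>R. {e \<in> E. h e = x})" by auto
  also have "card \<dots> = (\<Sum>x\<in>R. card {e \<in> E. h e = x})"
    using assms by (intro card_UN_disjoint) auto
  finally show ?thesis by (simp add: indeg_def)
qed

text \<open>The heads in \<open>R\<close> are counted by the sum of the indegrees over
  \<open>R\<close>, and the only summand that can be odd is the one at \<open>v\<close>.\<close>

lemma token_odd_heads:
  assumes "finite E" "finite R" "token_at E v h"
  shows "odd (card {e \<in> E. h e \<in> R}) \<longleftrightarrow> v \<in> R"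
proof -
  have "{x \<in> R. odd (indeg E h x)} = (if v \<in> R then {v} else {})"
    using assms(3) by (auto simp: token_at_def)
  then show ?thesis
    unfolding card_heads[OF assms(1,2)] using even_sum_iff[OF assms(2), of "indeg E h"] by auto
qed

text \<open>Reversing the edges of a walk one by one moves the parity change from vertex to vertex.
  Repeated edges do no harm, since each step reverses the edge as it currently points.\<close>

lemma flip_path:
  assumes "finite E" "F \<subseteq> E" "orients h E" "(\<lambda>x y. {x, y} \<in> F)\<^sup>*\<^sup>* a b"
  shows "\<exists>h'. orients h' E \<and> (\<forall>e. e \<notin> F \<longrightarrow> h' e = h e) \<and>
           (\<forall>x. odd (indeg E h' x) \<longleftrightarrow> (odd (indeg E h x) \<noteq> ((x = a) \<noteq> (x = b))))"
  using assms(4)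
proof (induction rule: rtranclp_induct)
  case base
  then show ?case using assms(3) by blast
next
  case (step y z)
  then obtain h' where h': "orients h' E" "\<And>e. e \<notin> F \<Longrightarrow> h' e = h e"
    "\<And>x. odd (indeg E h' x) \<longleftrightarrow> (odd (indeg E h x) \<noteq> ((x = a) \<noteq> (x = y)))" by blast
  have yz: "{y, z} \<in> E" using step assms(2) by auto
  then have hd: "h' {y, z} = y \<or> h' {y, z} = z" using h'(1) by (auto simp: orients_def)
  \<comment> \<open>The end of the edge that is not its current head.\<close>
  define w where "w = (if h' {y, z} = y then z else y)"
  have "orients (h'({y, z} := w)) E"
    using h'(1) by (auto simp: orients_def w_def)
  moreover have "(h'({y, z} := w)) e = h e" if "e \<notin> F" for e
    using that step h'(2) by auto
  moreover have "odd (indeg E (h'({y, z} := w)) x) \<longleftrightarrow> (odd (indeg E h x) \<noteq> ((x = a) \<noteq> (x = z)))" for x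
    unfolding indeg_fun_upd[OF assms(1) yz] h'(3) using hd by (auto simp: w_def)
  ultimately show ?case by blast
qed

text \<open>By maximality a component contains every edge that meets it, so its edges are exactly
  those with head in it, and their number is a sum of even indegrees.\<close>

lemma even_component:
  assumes D: "simple_graph D" and h: "orients h (edges D)" "\<And>x. even (indeg (edges D) h x)"
    and C: "component C D"
  shows "even (size_of C)"
proof -
  have sub: "simple_graph C" "verts C \<subseteq> verts D" "edges C \<subseteq> edges D"
    and conn: "connected_graph C"
    and max: "\<And>B. subgraph B D \<Longrightarrow> connected_graph B \<Longrightarrow> subgraph C B \<Longrightarrow> B = C"
    using C by (auto simp: component_def subgraph_def)
  have closed: "e \<in> edges C" if e: "e \<in> edges D" and a: "a \<in> e" "a \<in> verts C" for a e
  proof -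
    have "card e = 2" using D e by (auto simp: simple_graph_def)
    then obtain b where eab: "e = {a, b}" using a by (auto simp: card_2_iff)
    \<comment> \<open>Adding \<open>e\<close> to \<open>C\<close> keeps it connected, so maximality
      forces \<open>e\<close> to be in \<open>C\<close> already.\<close>
    define B :: "'a ugraph" where "B = \<lparr>verts = verts C \<union> e, edges = edges C \<union> {e}\<rparr>"
    have sB: "simple_graph B"
      using sub(1) eab \<open>card e = 2\<close> by (auto simp: simple_graph_def B_def)
    have 1: "subgraph B D"
      using sB sub e D unfolding subgraph_def by (auto simp: B_def simple_graph_def)
    have 2: "subgraph C B" using sub by (auto simp: subgraph_def B_def)
    have mono: "(adj B)\<^sup>*\<^sup>* x y" if "(adj C)\<^sup>*\<^sup>* x y" for x y
      using that by (rule mono_rtranclp[rule_format, rotated]) (auto simp: adj_def B_def)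
    have sym: "(adj B)\<^sup>*\<^sup>* x y" if "(adj B)\<^sup>*\<^sup>* y x" for x y
      using that
    proof (induction rule: rtranclp_induct)
      case (step w z)
      then have "adj B z w" by (simp add: adj_def insert_commute)
      then show ?case using step.IH by (rule converse_rtranclp_into_rtranclp)
    qed simp
    have ab: "(adj B)\<^sup>*\<^sup>* a b" using eab by (intro r_into_rtranclp) (auto simp: adj_def B_def)
    have "(adj B)\<^sup>*\<^sup>* a x" if "x \<in> verts B" for x
      using that conn a eab ab mono[of a x] by (auto simp: B_def connected_graph_def)
    then have 3: "connected_graph B"
      unfolding connected_graph_def
      using a sym by (auto simp: B_def intro: rtranclp_trans[of _ _ a])
    from max[OF 1 3 2] have "edges B = edges C" by simp
    then show ?thesis by (auto simp: B_def)
  qed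
  have fV: "finite (verts D)" using D by (simp add: simple_graph_def)
  have fE: "finite (edges D)"
    using D by (intro finite_subset[of "edges D" "Pow (verts D)"]) (auto simp: simple_graph_def)
  have "edges C = {e \<in> edges D. h e \<in> verts C}"
  proof (intro set_eqI iffI)
    fix e assume "e \<in> edges C"
    then show "e \<in> {e \<in> edges D. h e \<in> verts C}"
      using h(1) sub by (fastforce simp: orients_def simple_graph_def)
  next
    fix e assume "e \<in> {e \<in> edges D. h e \<in> verts C}"
    then show "e \<in> edges C" using closed[of e "h e"] h(1) by (simp add: orients_def)
  qed
  then have "card (edges C) = (\<Sum>x\<in>verts C. indeg (edges D) h x)"
    using card_heads[OF fE finite_subset[OF sub(2) fV]] by simp
  then show ?thesis using h(2) by (simp add: size_of_def dvd_sum)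
qed

section \<open>Orientations with a single vertex of odd indegree\<close>

locale odd_connected =
  fixes V :: "'a set" and E :: "'a set set"
  assumes fin_V: "finite V"
    and edge: "e \<in> E \<Longrightarrow> e \<subseteq> V \<and> card e = 2"
    and conn: "x \<in> V \<Longrightarrow> y \<in> V \<Longrightarrow> (\<lambda>x y. {x, y} \<in> E)\<^sup>*\<^sup>* x y"
    and odd_E: "odd (card E)"
begin

lemma fin_E: "finite E"
  using odd_E card.infinite by fastforce

lemma edge_nonempty: "{} \<notin> E"
  using edge[of "{}"] by auto

lemma edgeD: "{x, y} \<in> E \<Longrightarrow> x \<in> V \<and> y \<in> V \<and> x \<noteq> y"
  using edge[of "{x, y}"] by auto

lemma edgeE:
  assumes "e \<in> E" "x \<in> e" obtains y where "e = {x, y}" "x \<noteq> y"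
  using edge[OF assms(1)] assms(2) by (auto simp: card_2_iff)

text \<open>Start from any orientation. Flipping a walk to \<open>v\<close> from another vertex of
  odd indegree removes that vertex from \<open>?B\<close>. Once \<open>?B\<close> is empty,
  \<open>v\<close> must be odd, because the indegrees sum to the odd number
  \<open>card E\<close>.\<close>

lemma ex_token:
  assumes "v \<in> V" shows "\<exists>h. token_at E v h"
proof -
  let ?B = "\<lambda>h. {x. x \<noteq> v \<and> odd (indeg E h x)}"
  have BV: "?B h \<subseteq> V" if h: "orients h E" for h
  proof
    fix x assume "x \<in> ?B h"
    then have "indeg E h x \<noteq> 0" by (intro notI) auto
    then obtain e where "e \<in> E" "h e = x" by (auto simp: indeg_def dest: card_gt_0_iff[THEN iffD1])
    then show "x \<in> V" using h edge by (auto simp: orients_def)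
  qed
  have "\<exists>h'. token_at E v h'" if "orients h E" for h
    using that
  proof (induction "card (?B h)" arbitrary: h rule: less_induct)
    case less
    have fB: "finite (?B h)" using BV[OF less.prems] fin_V by (rule finite_subset)
    show ?case
    proof (cases "?B h = {}")
      case True
      have "{e \<in> E. h e \<in> V} = E" using less.prems edge by (auto simp: orients_def)
      then have "odd (\<Sum>x\<in>V. indeg E h x)" using card_heads[OF fin_E fin_V, of h] odd_E by simp
      then obtain x where "odd (indeg E h x)" by (meson dvd_sum)
      then have "odd (indeg E h v)" using True by auto
      then have "token_at E v h" using True less.prems by (auto simp: token_at_def)
      then show ?thesis by (rule exI[of _ h])
    next
      case False
      then obtain u where u: "u \<noteq> v" "odd (indeg E h u)" by auto
      then have "u \<in> V" using BV[OF less.prems] by auto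
      from flip_path[OF fin_E order_refl less.prems conn[OF this assms]]
      obtain h' where h': "orients h' E"
        "\<And>x. odd (indeg E h' x) \<longleftrightarrow> (odd (indeg E h x) \<noteq> ((x = u) \<noteq> (x = v)))" by blast
      have "?B h' = ?B h - {u}" using h'(2) u by auto
      then have "card (?B h') < card (?B h)" using fB u
        by (metis (mono_tags, lifting) card_Diff1_less mem_Collect_eq)
      then show ?thesis using less.hyps h'(1) by blast
    qed
  qed
  moreover have "orients (\<lambda>e. SOME x. x \<in> e) E"
    using edge by (auto simp: orients_def some_in_eq edge_nonempty)
  ultimately show ?thesis by blast
qed

end

section \<open>Graphs without a suitable subgraph\<close>

text \<open>The failure of the theorem in terms of orientations: by \<open>even_component\<close>,
  an \<open>H\<close> and \<open>h\<close> violating \<open>bad\<close> would give the desired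
  subgraph.\<close>

locale bad_graph = odd_connected +
  assumes bad: "H \<subseteq> E \<Longrightarrow> irregular_edges H \<Longrightarrow> orients h E \<Longrightarrow>
    (\<And>x. even (indeg (E - H) h x)) \<Longrightarrow> False"
begin

text \<open>The indegrees in \<open>H\<close> and in \<open>E\<close> have the same parity
  everywhere, so they leave even indegrees in \<open>E - H\<close>.\<close>

lemma no_irregular:
  assumes "H \<subseteq> E" "irregular_edges H" "token_at E v h"
    "\<And>x. odd (indeg H h x) \<longleftrightarrow> x = v"
  shows False
proof (rule bad[OF assms(1,2)])
  show "orients h E" using assms(3) by (simp add: token_at_def)
  show "even (indeg (E - H) h x)" for x
    using indeg_Diff[OF fin_E assms(1), of h x] assms(3,4) unfolding token_at_def
    by (metis even_add)
qed

lemma no_claw: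
  assumes h: "token_at E v h"
    and E: "{v, a} \<in> E" "{v, b} \<in> E" "{v, c} \<in> E" "a \<noteq> b" "a \<noteq> c" "b \<noteq> c"
    and in_v: "h {v, a} = v" "h {v, b} = v" "h {v, c} = v"
  shows False
proof -
  have ne: "v \<noteq> a" "v \<noteq> b" "v \<noteq> c" using E edgeD by blast+
  let ?H = "{{v, a}, {v, b}, {v, c}}"
  note d = edge_deg_insert edge_deg_empty indeg_insert indeg_empty doubleton_eq_iff
  have "irregular_edges ?H"
    unfolding irregular_edges_def using ne E(4-6) ne[symmetric] E(4-6)[symmetric]
    by (auto simp: d)
  moreover have "odd (indeg ?H h x) \<longleftrightarrow> x = v" for x
    using ne E(4-6) ne[symmetric] E(4-6)[symmetric] in_v by (auto simp: d)
  ultimately show False using no_irregular[of ?H v h] E h by auto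
qed

lemma indeg_token:
  assumes h: "token_at E v h"
  shows "indeg E h v = 1"
proof (rule ccontr)
  assume "indeg E h v \<noteq> 1"
  moreover have "odd (indeg E h v)" using h by (simp add: token_at_def)
  ultimately have "indeg E h v \<ge> 3" by (elim oddE) auto
  then obtain T where T: "T \<subseteq> {e \<in> E. h e = v}" "card T = 3"
    unfolding indeg_def by (meson obtain_subset_with_card_n)
  then obtain e f g where efg: "T = {e, f, g}" "e \<noteq> f" "e \<noteq> g" "f \<noteq> g"
    by (auto simp: card_3_iff)
  have "\<exists>y. k = {v, y}" if "k \<in> T" for k
  proof -
    have "k \<in> E" "v \<in> k" using that T h by (auto simp: token_at_def orients_def)
    then show ?thesis by (blast elim: edgeE)
  qed
  from this[of e] this[of f] this[of g] obtain a b c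
    where "e = {v, a}" "f = {v, b}" "g = {v, c}" using efg(1) by auto
  then show False using no_claw[OF h, of a b c] efg T by auto
qed

section \<open>Edges entering and leaving the vertex of odd indegree\<close>

lemma ex_in_edge:
  assumes h: "token_at E v h"
  obtains u where "{v, u} \<in> E" "h {v, u} = v"
proof -
  obtain e where "e \<in> E" "h e = v"
    using indeg_token[OF h] unfolding indeg_def by (metis (mono_tags, lifting) card_1_singletonE singletonI mem_Collect_eq)
  moreover from this have "v \<in> e" using h by (auto simp: token_at_def orients_def)
  ultimately show ?thesis using that by (metis edgeE)
qed

lemma out_edge:
  assumes h: "token_at E v h" and u: "{v, u} \<in> E" "h {v, u} = v" and w: "{v, w} \<in> E" "w \<noteq> u"
  shows "h {v, w} = w"
proof (rule ccontr)
  assume "h {v, w} \<noteq> w"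
  then have "h {v, w} = v" using h w by (auto simp: token_at_def orients_def)
  then have "{{v, u}, {v, w}} \<subseteq> {e \<in> E. h e = v}" using u w by auto
  then have "card {{v, u}, {v, w}} \<le> indeg E h v" unfolding indeg_def
    using fin_E by (intro card_mono) auto
  then show False using indeg_token[OF h] w(2) by (auto simp: doubleton_eq_iff card_insert_if split: if_splits)
qed

abbreviation linked_avoiding :: "'a \<Rightarrow> 'a \<Rightarrow> 'a \<Rightarrow> bool" where
  "linked_avoiding v \<equiv> (\<lambda>x y. {x, y} \<in> {e \<in> E. v \<notin> e})\<^sup>*\<^sup>*"

text \<open>Reversing the cycle through \<open>v\<close>, \<open>w\<close> and \<open>z\<close> would give \<open>v\<close> indegree 3.\<close>
lemma out_not_linked:
  assumes h: "token_at E v h" and u: "{v, u} \<in> E" "h {v, u} = v"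
    and w: "{v, w} \<in> E" "w \<noteq> u" and z: "{v, z} \<in> E" "z \<noteq> u" and "w \<noteq> z"
    and link: "linked_avoiding v w z"
  shows False
proof -
  have "orients h E" using h by (simp add: token_at_def)
  from flip_path[OF fin_E _ this link] obtain h' where h': "orients h' E"
    "\<And>e. v \<in> e \<Longrightarrow> h' e = h e"
    "\<And>x. odd (indeg E h' x) \<longleftrightarrow> (odd (indeg E h x) \<noteq> ((x = w) \<noteq> (x = z)))" by blast
  have hw: "h' {v, w} = w" "h' {v, z} = z"
    using out_edge[OF h u w] out_edge[OF h u z] h'(2) by auto
  have ne: "v \<noteq> w" "v \<noteq> z" using edgeD w z by blast+
  have d: "{v, z} \<noteq> {v, w}" using \<open>w \<noteq> z\<close> ne by (auto simp: doubleton_eq_iff)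
  \<comment> \<open>Turning \<open>vw\<close> and \<open>vz\<close> towards \<open>v\<close> undoes
    the parity changes that the flip made at \<open>w\<close> and \<open>z\<close>, and toggles
    \<open>v\<close> twice.\<close>
  define k where "k = (h'({v, w} := v))({v, z} := v)"
  have "odd (indeg E k x) \<longleftrightarrow> x = v" for x
    unfolding k_def indeg_fun_upd[OF fin_E z(1)] indeg_fun_upd[OF fin_E w(1)] h'(3)
    using h d hw ne by (auto simp: token_at_def)
  then have "token_at E v k" using h'(1) unfolding token_at_def orients_def k_def by auto
  moreover have "k {v, u} = v" "k {v, w} = v" "k {v, z} = v" using h' u by (auto simp: k_def)
  ultimately show False using no_claw[of v k u w z] u w z \<open>w \<noteq> z\<close> by auto
qed

text \<open>The edge \<open>vw\<close> enters \<open>w\<close>, whose indegree is even, so another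
  edge enters \<open>w\<close> as well.\<close>

lemma second_in_edge:
  assumes h: "token_at E v h" and u: "{v, u} \<in> E" "h {v, u} = v" and w: "{v, w} \<in> E" "w \<noteq> u"
  obtains w' where "w' \<noteq> v" "{w, w'} \<in> E" "h {w, w'} = w"
proof -
  have "w \<noteq> v" using w edgeD by blast
  then have "even (indeg E h w)" using h by (auto simp: token_at_def)
  moreover have "{v, w} \<in> {e \<in> E. h e = w}" using out_edge[OF h u w] w by auto
  ultimately have "{e \<in> E. h e = w} \<noteq> {{v, w}}" unfolding indeg_def by auto
  then obtain e where e: "e \<in> E" "h e = w" "e \<noteq> {v, w}"
    using \<open>{v, w} \<in> {e \<in> E. h e = w}\<close> by blast
  then have "w \<in> e" using h by (auto simp: token_at_def orients_def)
  then obtain w' where "e = {w, w'}" using e edgeE by metis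
  then show ?thesis using e that[of w'] by (auto simp: insert_commute)
qed

text \<open>Otherwise \<open>u\<close>, \<open>w\<close>, \<open>z\<close> and second in-neighbours
  \<open>w'\<close>, \<open>z'\<close> give the extended claw at \<open>v\<close>, with indegrees 1
  at \<open>v\<close>, 2 at \<open>w\<close> and \<open>z\<close>, and 0 elsewhere. Its vertices are
  distinct, because an edge \<open>wz\<close> or \<open>w' = z'\<close> would link \<open>w\<close>
  and \<open>z\<close> around \<open>v\<close>.\<close>

lemma out_adjacent_in:
  assumes h: "token_at E v h" and u: "{v, u} \<in> E" "h {v, u} = v"
    and w: "{v, w} \<in> E" "w \<noteq> u" and z: "{v, z} \<in> E" "z \<noteq> u" and "w \<noteq> z"
  shows "{u, w} \<in> E \<or> {u, z} \<in> E"
proof (rule ccontr)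
  assume nadj: "\<not> ({u, w} \<in> E \<or> {u, z} \<in> E)"
  obtain w' where w': "w' \<noteq> v" "{w, w'} \<in> E" "h {w, w'} = w" using second_in_edge[OF h u w] .
  obtain z' where z': "z' \<noteq> v" "{z, z'} \<in> E" "h {z, z'} = z" using second_in_edge[OF h u z] .
  note nl = out_not_linked[OF h u w z \<open>w \<noteq> z\<close>]
  have ne: "v \<noteq> u" "v \<noteq> w" "v \<noteq> z" "w \<noteq> w'" "z \<noteq> z'"
    using u(1) w(1) z(1) w'(2) z'(2) edgeD by blast+
  have wz: "{w, z} \<notin> E" using nl ne by (auto intro!: r_into_rtranclp)
  have "w' \<noteq> z'"
  proof
    assume "w' = z'"
    then have "linked_avoiding v w z" using ne w' z'
      by (intro converse_rtranclp_into_rtranclp[of _ w w'] r_into_rtranclp) (auto simp: insert_commute)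
    with nl show False .
  qed
  moreover have "w' \<noteq> u" "z' \<noteq> u" "w' \<noteq> z" "z' \<noteq> w"
    using nadj w' z' wz by (auto simp: insert_commute)
  moreover note ne w'(1) z'(1) w(2) z(2) \<open>w \<noteq> z\<close>
  ultimately have ne: "v \<noteq> u" "v \<noteq> w" "v \<noteq> z" "v \<noteq> w'" "v \<noteq> z'" "u \<noteq> w" "u \<noteq> z" "u \<noteq> w'" "u \<noteq> z'"
    "w \<noteq> z" "w \<noteq> w'" "w \<noteq> z'" "z \<noteq> w'" "z \<noteq> z'" "w' \<noteq> z'" by auto
  let ?H = "{{v, u}, {v, w}, {v, z}, {w, w'}, {z, z'}}"
  note d = edge_deg_insert edge_deg_empty indeg_insert indeg_empty doubleton_eq_iff
  have "irregular_edges ?H"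
    unfolding irregular_edges_def using ne ne[symmetric] by (auto simp: d)
  moreover have "odd (indeg ?H h x) \<longleftrightarrow> x = v" for x
    using ne ne[symmetric] u w'(3) z'(3) out_edge[OF h u w] out_edge[OF h u z] by (auto simp: d)
  ultimately show False using no_irregular[of ?H v h] u w z w' z' h by auto
qed

text \<open>The path \<open>w\<close>, \<open>u\<close>, \<open>z\<close> would avoid
  \<open>v\<close>.\<close>

lemma out_adjacent_in_unique:
  assumes h: "token_at E v h" and u: "{v, u} \<in> E" "h {v, u} = v"
    and w: "{v, w} \<in> E" "w \<noteq> u" and z: "{v, z} \<in> E" "z \<noteq> u" and "w \<noteq> z"
  shows "{u, w} \<notin> E \<or> {u, z} \<notin> E"
proof (rule ccontr)
  assume "\<not> ?thesis"
  moreover have "v \<noteq> u" "v \<noteq> w" "v \<noteq> z" using u(1) w(1) z(1) edgeD by blast+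
  ultimately have "linked_avoiding v w z"
    by (intro converse_rtranclp_into_rtranclp[of _ w u] r_into_rtranclp) (auto simp: insert_commute)
  with out_not_linked[OF assms] show False .
qed

text \<open>Among four neighbours at least three differ from \<open>u\<close>. Of any two of these
  exactly one is adjacent to \<open>u\<close>, which is impossible for three.\<close>

lemma degree_le_3:
  assumes "{v, a} \<in> E" "{v, b} \<in> E" "{v, c} \<in> E" "a \<noteq> b" "a \<noteq> c" "b \<noteq> c" "{v, x} \<in> E"
  shows "x = a \<or> x = b \<or> x = c"
proof (rule ccontr)
  assume x: "\<not> ?thesis"
  obtain h where h: "token_at E v h" using ex_token assms(1) edgeD by blast
  obtain u where u: "{v, u} \<in> E" "h {v, u} = v" using ex_in_edge[OF h] .
  have *: False if "p \<noteq> u" "q \<noteq> u" "r \<noteq> u" "{v, p} \<in> E" "{v, q} \<in> E" "{v, r} \<in> E"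
    "p \<noteq> q" "p \<noteq> r" "q \<noteq> r" for p q r
    using out_adjacent_in[OF h u, of p q] out_adjacent_in[OF h u, of p r]
      out_adjacent_in[OF h u, of q r] out_adjacent_in_unique[OF h u, of p q]
      out_adjacent_in_unique[OF h u, of p r] out_adjacent_in_unique[OF h u, of q r] that by auto
  show False
    using *[of a b c] *[of a b x] *[of a c x] *[of b c x] x assms by metis
qed

lemma degree_3_triangle:
  assumes "{v, a} \<in> E" "{v, b} \<in> E" "{v, c} \<in> E" "a \<noteq> b" "a \<noteq> c" "b \<noteq> c"
  shows "{a, b} \<in> E \<or> {a, c} \<in> E \<or> {b, c} \<in> E"
proof -
  obtain h where h: "token_at E v h" using ex_token assms(1) edgeD by blast
  obtain u where u: "{v, u} \<in> E" "h {v, u} = v" using ex_in_edge[OF h] .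
  have "u = a \<or> u = b \<or> u = c" using degree_le_3[OF assms u(1)] .
  then show ?thesis
    using out_adjacent_in[OF h u, of a b] out_adjacent_in[OF h u, of a c]
      out_adjacent_in[OF h u, of b c] assms by (auto simp: insert_commute)
qed

text \<open>If the edge into \<open>v\<close> came from \<open>b\<close>, then \<open>x\<close> and
  \<open>y\<close> would be linked out-neighbours. So it comes from \<open>x\<close> or
  \<open>y\<close>, and reversing a cycle through \<open>v\<close>, \<open>x\<close> and
  \<open>y\<close> exchanges the two.\<close>

lemma token_triangle:
  assumes v: "{v, x} \<in> E" "{v, y} \<in> E" "{v, b} \<in> E" "x \<noteq> b" "y \<noteq> b" and xy: "{x, y} \<in> E"
  obtains h where "token_at E v h" "h {v, x} = v"
proof -
  have ne: "x \<noteq> y" "v \<noteq> x" "v \<noteq> y" using xy v edgeD by blast+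
  have link: "linked_avoiding v x y" using xy ne by (intro r_into_rtranclp) auto
  obtain h where h: "token_at E v h" using ex_token v(1) edgeD by blast
  obtain u where u: "{v, u} \<in> E" "h {v, u} = v" using ex_in_edge[OF h] .
  have "u \<noteq> b" using out_not_linked[OF h u, of x y] link v ne by auto
  then consider "u = x" | "u = y" using degree_le_3[OF v(1-3) _ _ _ u(1)] v ne by auto
  then show ?thesis
  proof cases
    case 1
    then show ?thesis using that h u by auto
  next
    case 2
    have hx: "h {v, x} = x" using out_edge[OF h u v(1)] 2 ne by auto
    have "orients h E" using h by (simp add: token_at_def)
    from flip_path[OF fin_E _ this link] obtain h' where h': "orients h' E"
      "\<And>e. v \<in> e \<Longrightarrow> h' e = h e"
      "\<And>z. odd (indeg E h' z) \<longleftrightarrow> (odd (indeg E h z) \<noteq> ((z = x) \<noteq> (z = y)))" by blast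
    have d: "{v, y} \<noteq> {v, x}" using ne by (auto simp: doubleton_eq_iff)
    define k where "k = (h'({v, x} := v))({v, y} := y)"
    have "odd (indeg E k z) \<longleftrightarrow> z = v" for z
      unfolding k_def indeg_fun_upd[OF fin_E v(2)] indeg_fun_upd[OF fin_E v(1)] h'(3)
      using h d hx u 2 ne h'(2) by (auto simp: token_at_def)
    then have "token_at E v k" using h'(1) unfolding token_at_def orients_def k_def by auto
    moreover have "k {v, x} = v" using d by (auto simp: k_def)
    ultimately show ?thesis using that by blast
  qed
qed

section \<open>Bridges \<open>uv\<close> with the side \<open>R\<close> of \<open>v\<close>, and the
  parity of a side\<close>

definition cut :: "'a \<Rightarrow> 'a \<Rightarrow> 'a set \<Rightarrow> bool" where
  "cut u v R \<longleftrightarrow> {u, v} \<in> E \<and> v \<in> R \<and> u \<notin> R \<and> R \<subseteq> V \<and>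
     (\<forall>s t. {s, t} \<in> E \<longrightarrow> s \<in> R \<longrightarrow> t \<notin> R \<longrightarrow> s = v \<and> t = u)"

abbreviation odd_side :: "'a set \<Rightarrow> bool" where
  "odd_side R \<equiv> odd (card {e \<in> E. e \<subseteq> R})"

text \<open>The edges with head in \<open>R\<close> are those inside \<open>R\<close>, together with
  \<open>uv\<close> if it points to \<open>v\<close>; \<open>token_odd_heads\<close> gives the
  parity of their number.\<close>

lemma odd_side_iff:
  assumes c: "cut u v R" and h: "token_at E r h"
  shows "odd_side R \<longleftrightarrow> ((r \<in> R) \<noteq> (h {u, v} = v))"
proof -
  let ?S = "{e \<in> E. e \<subseteq> R}"
  have uv: "{u, v} \<in> E" "v \<in> R" "u \<notin> R" "R \<subseteq> V" using c by (auto simp: cut_def)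
  have h_in: "h e \<in> e" if "e \<in> E" for e using h that by (auto simp: token_at_def orients_def)
  have "e \<subseteq> R \<or> e = {u, v}" if e: "e \<in> E" "h e \<in> R" for e
  proof -
    obtain y where y: "e = {h e, y}" using edgeE e h_in by metis
    with e have E': "{h e, y} \<in> E" by simp
    have "y \<in> R \<or> (h e = v \<and> y = u)" using c e(2) E' unfolding cut_def by blast
    then show ?thesis using y e by (metis empty_subsetI insert_commute insert_subset)
  qed
  then have "{e \<in> E. h e \<in> R} = (if h {u, v} = v then insert {u, v} ?S else ?S)"
    using uv h_in by (auto simp: subset_iff) (metis h_in insertE singletonD)+
  then have "card {e \<in> E. h e \<in> R} = card ?S + (if h {u, v} = v then 1 else 0)"
    using fin_E uv by auto
  moreover have "finite R" using uv fin_V finite_subset by blast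
  ultimately show ?thesis using token_odd_heads[OF fin_E _ h, of R] by (auto split: if_splits)
qed

text \<open>\<open>R\<close> is what \<open>b\<close> reaches without \<open>v\<close>. By
  \<open>token_triangle\<close> either of \<open>x\<close>, \<open>y\<close> can be the in-neighbour
  of \<open>v\<close>; then the other and \<open>b\<close> are not linked, so neither lies in
  \<open>R\<close>. The edge \<open>vb\<close> points to \<open>b\<close> while the odd vertex
  \<open>v\<close> is outside, which makes the side odd.\<close>

lemma triangle_cut:
  assumes v: "{v, x} \<in> E" "{v, y} \<in> E" "{v, b} \<in> E" "x \<noteq> b" "y \<noteq> b" and xy: "{x, y} \<in> E"
  obtains R where "cut v b R" "odd_side R" "x \<notin> R" "y \<notin> R"
    "\<And>t. t \<in> R \<Longrightarrow> linked_avoiding v b t"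
proof -
  define R where "R = {t. linked_avoiding v b t}"
  have ne: "x \<noteq> y" "v \<noteq> x" "v \<noteq> y" "v \<noteq> b" using xy v edgeD by blast+
  obtain h where h: "token_at E v h" "h {v, x} = v" using token_triangle[OF assms] .
  obtain k where k: "token_at E v k" "k {v, y} = v"
    using token_triangle[OF v(2,1,3,5,4)] xy by (auto simp: insert_commute)
  have y: "y \<notin> R" using out_not_linked[OF h(1) v(1) h(2) v(3) _ v(2)] v ne by (auto simp: R_def)
  have x: "x \<notin> R" using out_not_linked[OF k(1) v(2) k(2) v(3) _ v(1)] v ne by (auto simp: R_def)
  have inV: "t \<in> V \<and> t \<noteq> v" if "t \<in> R" for t
  proof -
    from that have "linked_avoiding v b t" by (simp add: R_def)
    then show ?thesis by (cases rule: rtranclp.cases) (use v ne edgeD in auto)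
  qed
  have step: "t \<in> R" if "s \<in> R" "{s, t} \<in> E" "t \<noteq> v" for s t
    using that inV[OF that(1)] unfolding R_def by (auto intro: rtranclp.rtrancl_into_rtrancl)
  have "s = b \<and> t = v" if st: "{s, t} \<in> E" "s \<in> R" "t \<notin> R" for s t
  proof -
    have "t = v" using step st by blast
    moreover from this have "s = x \<or> s = y \<or> s = b"
      using degree_le_3[OF v(1-3) ne(1) v(4,5), of s] st by (auto simp: insert_commute)
    ultimately show ?thesis using st x y by auto
  qed
  then have c: "cut v b R"
    using v inV unfolding cut_def by (auto simp: R_def)
  moreover have "odd_side R"
    using odd_side_iff[OF c h(1)] out_edge[OF h(1) v(1) h(2) v(3)] v inV by auto
  ultimately show ?thesis using that x y by (auto simp: R_def)
qed

end

section \<open>Colour degrees\<close>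

locale coloured_bad_graph = bad_graph +
  fixes col :: "'a set \<Rightarrow> 'c"
  assumes col_irregular: "{x, y} \<in> E \<Longrightarrow>
    card {z. {x, z} \<in> E \<and> col {x, z} = col {x, y}} \<noteq> card {z. {y, z} \<in> E \<and> col {y, z} = col {x, y}}"
begin

text \<open>The degree of \<open>x\<close> in the subgraph of the decomposition that contains the edge \<open>xy\<close>.\<close>
definition cdeg :: "'a \<Rightarrow> 'a \<Rightarrow> nat" where
  "cdeg x y = card {z. {x, z} \<in> E \<and> col {x, z} = col {x, y}}"

lemma cdeg_neq: "{x, y} \<in> E \<Longrightarrow> cdeg x y \<noteq> cdeg y x"
  using col_irregular[of x y] by (simp add: cdeg_def insert_commute)

lemma cdeg_eq:
  assumes "{z. {x, z} \<in> E} = N"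
  shows "cdeg x y = card {z \<in> N. col {x, z} = col {x, y}}"
  unfolding cdeg_def using assms by (intro arg_cong[of _ _ card]) auto

lemma cdeg_1:
  assumes "{z. {x, z} \<in> E} = {y}"
  shows "cdeg x y = 1"
proof -
  have "{z \<in> {y}. col {x, z} = col {x, y}} = {y}" by auto
  then show ?thesis using cdeg_eq[OF assms] by simp
qed

lemma cdeg_2:
  assumes "{z. {x, z} \<in> E} = {y, w}" "y \<noteq> w"
  shows "cdeg x y = 1 + of_bool (col {x, y} = col {x, w})"
proof -
  have "{z \<in> {y, w}. col {x, z} = col {x, y}} = (if col {x, y} = col {x, w} then {y, w} else {y})"
    by auto
  then show ?thesis using cdeg_eq[OF assms(1), of y] assms(2) by simp
qed

lemma cdeg_3:
  assumes "{z. {x, z} \<in> E} = {y, w, t}" "y \<noteq> w" "y \<noteq> t" "w \<noteq> t"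
  shows "cdeg x y = 1 + of_bool (col {x, y} = col {x, w}) + of_bool (col {x, y} = col {x, t})"
proof -
  have "{z \<in> {y, w, t}. col {x, z} = col {x, y}} = {y} \<union> (if col {x, y} = col {x, w} then {w} else {})
     \<union> (if col {x, y} = col {x, t} then {t} else {})"
    by auto
  then show ?thesis using cdeg_eq[OF assms(1), of y] assms(2-) by simp
qed

text \<open>\<open>\<alpha>\<close> says that a third edge at \<open>x\<close> exists and has the colour of both triangle edges.\<close>
lemma cdeg_triangle:
  assumes E: "{x, y} \<in> E" "{x, z} \<in> E" and "y \<noteq> z"
    and third: "\<And>b. {x, b} \<in> E \<Longrightarrow> b \<noteq> y \<Longrightarrow> b \<noteq> z \<Longrightarrow> cdeg x b \<noteq> 2"
  obtains \<alpha> where "\<alpha> \<Longrightarrow> col {x, y} = col {x, z}"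
    "cdeg x y = 1 + of_bool (col {x, y} = col {x, z}) + of_bool \<alpha>"
    "cdeg x z = 1 + of_bool (col {x, y} = col {x, z}) + of_bool \<alpha>"
proof (cases "\<exists>b. {x, b} \<in> E \<and> b \<noteq> y \<and> b \<noteq> z")
  case False
  then have N: "{t. {x, t} \<in> E} = {y, z}" "{t. {x, t} \<in> E} = {z, y}" using E by auto
  show ?thesis
    using that[of False] cdeg_2[OF N(1)] cdeg_2[OF N(2)] \<open>y \<noteq> z\<close> by (auto simp: eq_commute)
next
  case True
  then obtain b where b: "{x, b} \<in> E" "b \<noteq> y" "b \<noteq> z" by blast
  then have N: "{t. {x, t} \<in> E} = {y, z, b}"
    using E degree_le_3[OF E b(1)] \<open>y \<noteq> z\<close> by auto
  then have N': "{t. {x, t} \<in> E} = {z, y, b}" "{t. {x, t} \<in> E} = {b, y, z}" by auto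
  let ?A = "col {x, y}" and ?B = "col {x, z}" and ?C = "col {x, b}"
  have d: "cdeg x y = 1 + of_bool (?A = ?B) + of_bool (?A = ?C)"
    "cdeg x z = 1 + of_bool (?A = ?B) + of_bool (?B = ?C)"
    "cdeg x b = 1 + of_bool (?A = ?C) + of_bool (?B = ?C)"
    using cdeg_3[OF N] cdeg_3[OF N'(1)] cdeg_3[OF N'(2)] b \<open>y \<noteq> z\<close> by (simp_all add: eq_commute)
  \<comment> \<open>If the third edge shared its colour with exactly one triangle edge, its colour
    degree at \<open>x\<close> would be 2.\<close>
  have iff: "?A = ?C \<longleftrightarrow> ?B = ?C"
    using third[OF b] unfolding d(3) by (cases "?A = ?C"; cases "?B = ?C") simp_all
  show ?thesis
  proof (rule that[of "?A = ?C"])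
    show "?A = ?B" if "?A = ?C" using that iff by simp
    show "cdeg x z = 1 + of_bool (?A = ?B) + of_bool (?A = ?C)" unfolding d(2) iff ..
  qed (rule d(1))
qed

text \<open>If the three triangle edges do not all have one colour, then at two of the vertices they
  differ, and both of these have colour degree 1 along their common edge. If they do, the three
  vertices have colour degrees in {2, 3}, so two of them agree. Both cases contradict
  \<open>cdeg_neq\<close>.\<close>

lemma no_triangle_thirds:
  assumes E: "{x, y} \<in> E" "{x, z} \<in> E" "{y, z} \<in> E"
    and third: "\<And>b. {x, b} \<in> E \<Longrightarrow> b \<noteq> y \<Longrightarrow> b \<noteq> z \<Longrightarrow> cdeg x b \<noteq> 2"
      "\<And>b. {y, b} \<in> E \<Longrightarrow> b \<noteq> x \<Longrightarrow> b \<noteq> z \<Longrightarrow> cdeg y b \<noteq> 2"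
      "\<And>b. {z, b} \<in> E \<Longrightarrow> b \<noteq> x \<Longrightarrow> b \<noteq> y \<Longrightarrow> cdeg z b \<noteq> 2"
  shows False
proof -
  have E': "{y, x} \<in> E" "{z, x} \<in> E" "{z, y} \<in> E" using E by (auto simp: insert_commute)
  have ne: "x \<noteq> y" "x \<noteq> z" "y \<noteq> z" using E edgeD by blast+
  have sym: "{y, x} = {x, y}" "{z, x} = {x, z}" "{z, y} = {y, z}" by auto
  obtain \<alpha> where a: "\<alpha> \<Longrightarrow> col {x, y} = col {x, z}"
    "cdeg x y = 1 + of_bool (col {x, y} = col {x, z}) + of_bool \<alpha>"
    "cdeg x z = 1 + of_bool (col {x, y} = col {x, z}) + of_bool \<alpha>"
    using cdeg_triangle[OF E(1,2) ne(3) third(1)] by blast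
  obtain \<beta> where b: "\<beta> \<Longrightarrow> col {x, y} = col {y, z}"
    "cdeg y x = 1 + of_bool (col {x, y} = col {y, z}) + of_bool \<beta>"
    "cdeg y z = 1 + of_bool (col {x, y} = col {y, z}) + of_bool \<beta>"
    using cdeg_triangle[OF E'(1) E(3) ne(2) third(2)] unfolding sym by blast
  obtain \<gamma> where c: "\<gamma> \<Longrightarrow> col {x, z} = col {y, z}"
    "cdeg z x = 1 + of_bool (col {x, z} = col {y, z}) + of_bool \<gamma>"
    "cdeg z y = 1 + of_bool (col {x, z} = col {y, z}) + of_bool \<gamma>"
    using cdeg_triangle[OF E'(2,3) ne(1) third(3)] unfolding sym by blast
  have "cdeg x y \<noteq> cdeg y x" "cdeg x z \<noteq> cdeg z x" "cdeg y z \<noteq> cdeg z y"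
    using cdeg_neq E by auto
  then show False
    using a(1) b(1) c(1) unfolding a(2,3) b(2,3) c(2,3)
    by (auto simp: of_bool_def split: if_splits)
qed

text \<open>Induction on the size of the side, split by whether \<open>v\<close> has one, two or
  three neighbours. Bridges beyond \<open>v\<close> have smaller sides, and by
  \<open>cdeg_neq\<close> the value at their far end excludes the same value at the near
  end.\<close>

lemma cdeg_cut:
  assumes "cut u v R"
  shows "cdeg v u = (if odd_side R then 2 else 1)"
  using assms
proof (induction "card R" arbitrary: u v R rule: less_induct)
  case less
  note c = less.prems
  have uv: "{u, v} \<in> E" "{v, u} \<in> E" "v \<in> R" "u \<notin> R" "R \<subseteq> V" "u \<noteq> v"
    using c edgeD by (auto simp: cut_def insert_commute)
  have stay: "t \<in> R" if "{s, t} \<in> E" "s \<in> R" "s \<noteq> v \<or> t \<noteq> u" for s t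
    using c that unfolding cut_def by blast
  have fR: "finite R" using uv fin_V finite_subset by blast
  obtain h where h: "token_at E v h" using ex_token uv by blast
  consider (leaf) "{z. {v, z} \<in> E} = {u}"
    | (two) z where "{z. {v, z} \<in> E} = {u, z}" "z \<noteq> u"
    | (three) x y where "{v, x} \<in> E" "{v, y} \<in> E" "x \<noteq> u" "y \<noteq> u" "x \<noteq> y"
    using uv(2) by blast
  then show ?case
  proof cases
    case leaf
    obtain w where w: "{v, w} \<in> E" "h {v, w} = v" using ex_in_edge[OF h] .
    then have "w = u" using leaf by auto
    \<comment> \<open>The single edge at \<open>v\<close> has to enter \<open>v\<close>, which lies
      in \<open>R\<close>.\<close>
    then have "\<not> odd_side R" using odd_side_iff[OF c h] w uv by (simp add: insert_commute)
    then show ?thesis using cdeg_1[OF leaf] by simp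
  next
    case two
    then have vz: "{v, z} \<in> E" "z \<noteq> v" using edgeD by blast+
    then have zR: "z \<in> R" using stay uv two by blast
    have N: "t = u \<or> t = z" if "{v, t} \<in> E" for t using two that by blast
    have edge_out: "s = z \<and> t = v" if st: "{s, t} \<in> E" "s \<in> R - {v}" "t \<notin> R - {v}" for s t
    proof -
      have "t = v" using st stay by blast
      then show ?thesis using N[of s] st uv by (auto simp: insert_commute)
    qed
    \<comment> \<open>The next edge \<open>vz\<close> is a bridge too, and its side has one edge
      fewer, so the parity changes. Both \<open>cdeg v z = cdeg v u\<close> and
      \<open>cdeg z v\<close> are 1 or 2, and they differ.\<close>
    have c': "cut v z (R - {v})"
      unfolding cut_def using vz zR uv(5) edge_out by (intro conjI allI impI) blast+
    have "e \<subseteq> R - {v} \<or> e = {v, z}" if e: "e \<in> E" "e \<subseteq> R" for e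
    proof (cases "v \<in> e")
      case True
      then obtain t where t: "e = {v, t}" using edgeE e by metis
      then show ?thesis using N[of t] e uv by auto
    qed (use e in auto)
    then have "{e \<in> E. e \<subseteq> R} = insert {v, z} {e \<in> E. e \<subseteq> R - {v}}" using vz zR uv by auto
    then have "card {e \<in> E. e \<subseteq> R} = Suc (card {e \<in> E. e \<subseteq> R - {v}})"
      using fin_E by simp
    moreover have "cdeg z v = (if odd_side (R - {v}) then 2 else 1)"
      using less.hyps[OF _ c'] fR uv by (meson card_Diff1_less)
    moreover have "cdeg v z \<noteq> cdeg z v" using cdeg_neq vz by blast
    moreover have "{z. {v, z} \<in> E} = {z, u}" using two(1) by auto
    from cdeg_2[OF this] have "cdeg v z = 1 + of_bool (col {v, u} = col {v, z})"
      using two(2) by (simp add: eq_commute)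
    moreover have "cdeg v u = 1 + of_bool (col {v, u} = col {v, z})"
      using cdeg_2[OF two(1)] two(2) by simp
    ultimately show ?thesis by (auto split: if_splits)
  next
    case three
    have ne: "x \<noteq> v" "y \<noteq> v" using three edgeD by blast+
    have inR: "x \<in> R" "y \<in> R" using stay uv three by blast+
    have "{x, u} \<notin> E" "{y, u} \<notin> E" using stay[of x u] stay[of y u] inR ne uv by auto
    then have xy: "{x, y} \<in> E" "{y, x} \<in> E"
      using degree_3_triangle[OF three(1,2) uv(2)] three by (auto simp: insert_commute)
    have E': "{x, v} \<in> E" "{y, v} \<in> E" using three by (auto simp: insert_commute)
    obtain k where k: "token_at E v k" "k {v, x} = v"
      using token_triangle[OF three(1,2) uv(2) three(3,4) xy(1)] .
    have "odd_side R"
      using odd_side_iff[OF c k(1)] out_edge[OF k(1) three(1) k(2) uv(2)] three uv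
      by (auto simp: insert_commute)
    \<comment> \<open>A third edge at a triangle vertex \<open>p\<close> other than \<open>v\<close>
      is a bridge with an odd side inside \<open>R\<close>, so the induction hypothesis gives 2 at
      its far end \<open>b\<close>.\<close>
    moreover have third: "cdeg p b \<noteq> 2"
      if p: "{p, v} \<in> E" "{p, q} \<in> E" "{v, q} \<in> E" "p \<in> R" "{p, b} \<in> E" "b \<noteq> v" "b \<noteq> q" for p q b
    proof -
      obtain S where S: "cut p b S" "odd_side S" "v \<notin> S" "\<And>t. t \<in> S \<Longrightarrow> linked_avoiding p b t"
        by (rule triangle_cut[OF p(1,2,5) p(6)[symmetric] p(7)[symmetric] p(3)]) blast
      have pv: "p \<noteq> v" using p edgeD by blast
      have "S \<subseteq> R"
      proof
        fix t assume "t \<in> S"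
        then have "linked_avoiding p b t" using S by blast
        then show "t \<in> R"
          using \<open>t \<in> S\<close>
        proof (induction rule: rtranclp_induct)
          case base
          then show ?case using stay p pv by blast
        next
          case (step s t)
          \<comment> \<open>The only edge leaving \<open>S\<close> contains \<open>p\<close>, which
            the walk avoids. So the walk stays in \<open>S\<close>, misses \<open>v\<close>, and
            cannot leave \<open>R\<close>.\<close>
          have "s \<in> S"
          proof (rule ccontr)
            assume "s \<notin> S"
            moreover have "{t, s} \<in> E" using step(2) by (simp add: insert_commute)
            ultimately have "t = b \<and> s = p"
              using S(1) step(4) unfolding cut_def by blast
            then show False using step(2) by auto
          qed
          then have "s \<in> R" "s \<noteq> v" using step S by auto
          then show ?case using stay step by blast
        qed
      qed
      moreover have "p \<notin> S" using S(1) by (simp add: cut_def)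
      ultimately have "card S < card R" using fR p(4) by (metis psubsetI psubset_card_mono)
      from less.hyps[OF this S(1)] have "cdeg b p = 2" using S(2) by simp
      then show ?thesis using cdeg_neq[OF p(5)] by simp
    qed
    have N: "b = u" if "{v, b} \<in> E" "b \<noteq> x" "b \<noteq> y" for b
      using degree_le_3[OF three(1,2) uv(2) _ _ _ that(1)] three that by auto
    have "cdeg v u = 2"
    proof (rule ccontr)
      assume "cdeg v u \<noteq> 2"
      then show False
        using no_triangle_thirds[OF three(1,2) xy(1)] N third[of x y] third[of y x] E' xy three inR
        by blast
    qed
    ultimately show ?thesis by simp
  qed
qed

text \<open>The odd number \<open>card E\<close> is 1 plus the sizes of both sides, so the sides
  have equal parity, and \<open>cdeg_cut\<close> from both ends contradicts
  \<open>cdeg_neq\<close>.\<close>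

lemma no_cut: "\<not> cut u v R"
proof
  assume c: "cut u v R"
  have "s = u \<and> t = v" if "{s, t} \<in> E" "s \<in> V - R" "t \<notin> V - R" for s t
  proof -
    have "{t, s} \<in> E" "t \<in> R" using that edgeD by (auto simp: insert_commute)
    then show ?thesis using c that unfolding cut_def by blast
  qed
  then have c': "cut v u (V - R)"
    using c edgeD[of u v] unfolding cut_def by (auto simp: insert_commute)
  have uv: "{u, v} \<in> E" "v \<in> R" "u \<notin> R" "R \<subseteq> V" "u \<in> V"
    using c edgeD by (auto simp: cut_def)
  let ?A = "{e \<in> E. e \<subseteq> R}" and ?B = "{e \<in> E. e \<subseteq> V - R}"
  have "e \<in> insert {u, v} (?A \<union> ?B)" if e: "e \<in> E" for e
  proof -
    obtain s t where st: "e = {s, t}" using edge[OF e] by (auto simp: card_2_iff)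
    moreover from this have "s \<in> V" "t \<in> V" "{t, s} \<in> E" using e edgeD by (auto simp: insert_commute)
    ultimately show ?thesis using c e unfolding cut_def by (cases "s \<in> R"; cases "t \<in> R") auto
  qed
  then have "E = insert {u, v} (?A \<union> ?B)" using uv by auto
  then have "card E = card (insert {u, v} (?A \<union> ?B))" by simp
  also have "\<dots> = Suc (card (?A \<union> ?B))" using fin_E uv by (subst card_insert_disjoint) auto
  also have "card (?A \<union> ?B) = card ?A + card ?B"
  proof (rule card_Un_disjoint)
    have "e = {}" if "e \<subseteq> R" "e \<subseteq> V - R" for e using that by blast
    then show "?A \<inter> ?B = {}" using edge_nonempty by blast
  qed (use fin_E in auto)
  finally have "odd_side R \<longleftrightarrow> odd_side (V - R)" using odd_E by simp
  then have "cdeg v u = cdeg u v" using cdeg_cut[OF c] cdeg_cut[OF c'] by simp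
  then show False using cdeg_neq[OF uv(1)] by simp
qed

text \<open>A leaf edge is a bridge. A third neighbour would put \<open>x\<close> on a triangle, and
  \<open>triangle_cut\<close> would yield a bridge.\<close>

lemma two_neighbours:
  assumes "{x, a} \<in> E"
  obtains b where "{z. {x, z} \<in> E} = {a, b}" "a \<noteq> b"
proof -
  have "\<exists>b. {x, b} \<in> E \<and> b \<noteq> a"
  proof (rule ccontr)
    assume "\<not> ?thesis"
    then have "cut a x {x}" using assms edgeD[OF assms] by (auto simp: cut_def insert_commute)
    then show False using no_cut by blast
  qed
  then obtain b where b: "{x, b} \<in> E" "b \<noteq> a" by blast
  have no_tri: False
    if "{x, p} \<in> E" "{x, q} \<in> E" "{x, r} \<in> E" "p \<noteq> r" "q \<noteq> r" "{p, q} \<in> E" for p q r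
    by (rule triangle_cut[OF that]) (simp add: no_cut)
  have "z = a \<or> z = b" if z: "{x, z} \<in> E" for z
  proof (rule ccontr)
    assume ne: "\<not> ?thesis"
    then consider "{a, b} \<in> E" | "{a, z} \<in> E" | "{b, z} \<in> E"
      using degree_3_triangle[OF assms b(1) z] b(2) by blast
    then show False
      using no_tri[OF assms b(1) z] no_tri[OF assms z b(1)] no_tri[OF b(1) z assms] ne b(2)
      by cases auto
  qed
  then show ?thesis using that[of b] assms b by auto
qed

text \<open>All vertices have degree 2; orienting each edge towards its end of colour degree 2
  makes all indegrees 0 or 2.\<close>
lemma contradiction: False
proof -
  have val: "cdeg x a = 1 \<or> cdeg x a = 2" if xa: "{x, a} \<in> E" for x a
  proof -
    obtain b where "{z. {x, z} \<in> E} = {a, b}" "a \<noteq> b" using two_neighbours[OF xa] .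
    from cdeg_2[OF this] show ?thesis by (simp split: split_of_bool)
  qed
  \<comment> \<open>The colour degrees at the two ends are distinct elements of {1, 2}.\<close>
  have ex: "\<exists>x. x \<in> e \<and> (\<forall>y. e = {x, y} \<longrightarrow> cdeg x y = 2)" if e: "e \<in> E" for e
  proof -
    obtain s t where st: "e = {s, t}" "s \<noteq> t" using edge[OF e] by (auto simp: card_2_iff)
    then have "cdeg s t = 2 \<or> cdeg t s = 2"
      using val[of s t] val[of t s] cdeg_neq[of s t] e by (auto simp: insert_commute)
    then show ?thesis using st by (auto simp: doubleton_eq_iff)
  qed
  define h where "h e = (SOME x. x \<in> e \<and> (\<forall>y. e = {x, y} \<longrightarrow> cdeg x y = 2))" for e
  have h: "h e \<in> e" "e = {h e, y} \<Longrightarrow> cdeg (h e) y = 2" if "e \<in> E" for e y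
    using someI_ex[OF ex[OF that]] unfolding h_def by blast+
  have h_iff: "h {x, y} = x \<longleftrightarrow> cdeg x y = 2" if e: "{x, y} \<in> E" for x y
  proof -
    have "h {x, y} = x \<or> h {x, y} = y" using h(1)[OF e] by auto
    then show ?thesis using h(2)[OF e, of x] h(2)[OF e, of y] cdeg_neq[OF e]
      by (auto simp: insert_commute)
  qed
  have "even (indeg E h x)" for x
  proof (cases "\<exists>a. {x, a} \<in> E")
    case False
    have "h e \<noteq> x" if "e \<in> E" for e
      using edgeE[OF that h(1)[OF that]] that False by metis
    then have "{e \<in> E. h e = x} = {}" by blast
    then show ?thesis by (simp only: indeg_def card.empty even_zero)
  next
    case True
    then obtain a b where N: "{z. {x, z} \<in> E} = {a, b}" "a \<noteq> b" using two_neighbours by metis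
    then have E': "{x, a} \<in> E" "{x, b} \<in> E" by blast+
    have N': "{z. {x, z} \<in> E} = {b, a}" using N by auto
    \<comment> \<open>Both are 1 plus the same indicator, so either both edges at \<open>x\<close>
      point to \<open>x\<close> or neither does.\<close>
    have ab: "cdeg x a = cdeg x b" using cdeg_2[OF N] cdeg_2[OF N'] N(2) by (simp add: eq_commute)
    have only: "e = {x, a} \<or> e = {x, b}" if e: "e \<in> E" "h e = x" for e
    proof -
      obtain z where z: "e = {x, z}" using edgeE[OF e(1) h(1)[OF e(1)]] e(2) by metis
      with e(1) have "z \<in> {z. {x, z} \<in> E}" by simp
      then have "z = a \<or> z = b" unfolding N by simp
      with z show ?thesis by blast
    qed
    show ?thesis
    proof (cases "cdeg x a = 2")
      case True
      then have "h {x, a} = x" "h {x, b} = x" using h_iff E' ab by auto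
      then have "e \<in> E \<and> h e = x \<longleftrightarrow> e = {x, a} \<or> e = {x, b}" for e
        using only[of e] E' by metis
      then have "{e \<in> E. h e = x} = {{x, a}, {x, b}}" by blast
      moreover have "{x, a} \<noteq> {x, b}" using N(2) by (auto simp: doubleton_eq_iff)
      ultimately show ?thesis by (simp add: indeg_def)
    next
      case False
      then have "h {x, a} \<noteq> x" "h {x, b} \<noteq> x" using h_iff E' ab by auto
      then have "h e \<noteq> x" if "e \<in> E" for e using only[OF that] by metis
      then have "{e \<in> E. h e = x} = {}" by blast
      then show ?thesis by (simp only: indeg_def card.empty even_zero)
    qed
  qed
  moreover have "{e \<in> E. h e \<in> V} = E" using h(1) edge by auto
  then have "card E = (\<Sum>x\<in>V. indeg E h x)" using card_heads[OF fin_E fin_V, of h] by simp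
  ultimately show False using odd_E by (simp add: dvd_sum)
qed

end

section \<open>Passage between graphs and edge sets\<close>

theorem theorem7:
  fixes G :: "'a ugraph"
  assumes "simple_graph G"
    and "connected_graph G"
    and "odd (size_of G)"
    and "decomposable G"
  shows "\<exists>H. subgraph H G \<and> locally_irregular H \<and>
             (\<forall>C. component C (delete_edges G (edges H)) \<longrightarrow> even (size_of C))"
proof (rule ccontr)
  assume contr: "\<not> ?thesis"
  let ?V = "verts G" and ?E = "edges G"
  have edge: "e \<subseteq> ?V" "card e = 2" if "e \<in> ?E" for e
    using assms(1) that by (auto simp: simple_graph_def)
  have "adj G = (\<lambda>x y. {x, y} \<in> ?E)" by (intro ext) (simp add: adj_def)
  then interpret odd_connected ?V ?E
    using assms(1-3) by unfold_locales (auto simp: simple_graph_def connected_graph_def size_of_def)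
  interpret bad_graph ?V ?E
  proof
    fix F h assume F: "F \<subseteq> ?E" "irregular_edges F" and h: "orients h ?E"
      "\<And>x. even (indeg (?E - F) h x)"
    define H :: "'a ugraph" where "H = \<lparr>verts = ?V, edges = F\<rparr>"
    have "subgraph H G" using F edge fin_V by (auto simp: H_def subgraph_def simple_graph_def)
    moreover have "locally_irregular H"
      using F(2) by (auto simp: H_def locally_irregular_def irregular_edges_def adj_def degree_def
          edge_deg_def)
    moreover have "even (size_of C)" if C: "component C (delete_edges G (edges H))" for C
    proof (rule even_component[OF _ _ _ C, of h])
      show "simple_graph (delete_edges G (edges H))"
        using assms(1) by (auto simp: simple_graph_def delete_edges_def)
      show "orients h (edges (delete_edges G (edges H)))"
        using h(1) by (auto simp: orients_def delete_edges_def)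
      show "even (indeg (edges (delete_edges G (edges H))) h x)" for x
        using h(2)[of x] by (simp add: delete_edges_def H_def)
    qed
    ultimately show False using contr by blast
  qed
  obtain P where P: "partition_on ?E P"
    "\<And>F. F \<in> P \<Longrightarrow> \<exists>H. subgraph H G \<and> locally_irregular H \<and> edges H = F"
    using assms(4) by (auto simp: decomposable_def)
  \<comment> \<open>The colour of an edge is its block of the partition, so the colour classes are
    the edge sets of locally irregular subgraphs.\<close>
  define col where "col e = (THE F. F \<in> P \<and> e \<in> F)" for e
  have col: "col e = F" if "F \<in> P" "e \<in> F" for e F
    unfolding col_def
  proof (rule the_equality)
    show "F' = F" if F': "F' \<in> P \<and> e \<in> F'" for F'
    proof (rule ccontr)
      assume "F' \<noteq> F"
      then have "F' \<inter> F = {}"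
        using disjointD[OF partition_onD2[OF P(1)]] F' \<open>F \<in> P\<close> by blast
      then show False using F' \<open>e \<in> F\<close> by blast
    qed
  qed (use that in simp)
  interpret coloured_bad_graph ?V ?E col
  proof
    fix x y assume xy: "{x, y} \<in> ?E"
    then obtain F where F: "F \<in> P" "{x, y} \<in> F" using partition_onD1[OF P(1)] by auto
    obtain H where H: "subgraph H G" "locally_irregular H" "edges H = F" using P(2)[OF F(1)] by blast
    \<comment> \<open>Neighbours \<open>z\<close> correspond to edges \<open>{s, z}\<close>, which
      turns the neighbour count of the locale into a degree in \<open>H\<close>.\<close>
    have deg: "card {z. {s, z} \<in> ?E \<and> col {s, z} = col {x, y}} = degree H s" for s
    proof -
      have "e \<in> F \<longleftrightarrow> e \<in> ?E \<and> col e = col {x, y}" for e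
        using F col partition_onD1[OF P(1)] by auto
      moreover have "e \<in> range (\<lambda>z. {s, z})" if "e \<in> ?E" "s \<in> e" for e
        using edgeE[OF that] by blast
      ultimately have "{e \<in> edges H. s \<in> e} =
          (\<lambda>z. {s, z}) ` {z. {s, z} \<in> ?E \<and> col {s, z} = col {x, y}}"
        unfolding H(3) by blast
      moreover have "inj_on (\<lambda>z. {s, z}) A" for A
        by (auto simp: inj_on_def doubleton_eq_iff)
      ultimately show ?thesis by (simp add: degree_def card_image)
    qed
    have "x \<in> verts H" "y \<in> verts H" using H F(2) by (auto simp: subgraph_def simple_graph_def)
    then show "card {z. {x, z} \<in> ?E \<and> col {x, z} = col {x, y}}
        \<noteq> card {z. {y, z} \<in> ?E \<and> col {y, z} = col {x, y}}"
      unfolding deg using H(2,3) F(2) by (auto simp: locally_irregular_def adj_def)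
  qed
  show False by (rule contradiction)
qed

end
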